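(* Let $\mathcal{A}:\mathbb{R}^{m\times n}\to\mathbb{R}^l$ be a linear map, let $\bm{b}\in\mathbb{R}^l$ be nonzero, and let $\mathcal{F}=\{\bm{X}\in\mathbb{R}^{m\times n} : \mathcal{A}(\bm{X})=\bm{b}\}$. Suppose $\bm{X}^*$ is the unique global minimizer of $\operatorname{rank}(\bm{X})$ over $\bm{X}\in\mathcal{F}$, with $\operatorname{rank}(\bm{X}^* )=s$, and suppose that for every $\bm{X}\in\mathcal{F}_L\setminus\{\bm{X}^*\}$, $$\min_{i\in\operatorname{supp}(\sigma(\bm{X}))}\sigma_i(\bm{X})>\frac{2(\sqrt{s}-1)}{\operatorname{rank}(\bm{X})-1}\,\|\bm{X}^*\|_F .$$ Then $\bm{X}^*$ is also the unique global minimizer of $\|\bm{X}\|_*-\|\bm{X}\|_F$ over $\bm{X}\in\mathcal{F}$.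
   Context: Let $t=\min\{m,n\}$. $\sigma(\bm{X})=(\sigma_1(\bm{X}),\dots,\sigma_t(\bm{X}))$ is the vector of singular values of $\bm{X}\in\mathbb{R}^{m\times n}$, with $\sigma_1(\bm{X})\ge\cdots\ge\sigma_t(\bm{X})\ge 0$; $\|\bm{X}\|_*=\sum_i\sigma_i(\bm{X})$ is the nuclear norm and $\|\bm{X}\|_F$ the Frobenius norm. For $\bm{x}\in\mathbb{R}^t$, $\mathcal{D}(\bm{x})\in\mathbb{R}^{m\times n}$ has entries $\mathcal{D}_{ii}(\bm{x})=x_i$ and zeros off the diagonal. $\mathcal{O}(d)$ is the group of $d\times d$ orthogonal matrices, and $\operatorname{supp}(\bm{x})$ is the set of indices of nonzero entries of $\bm{x}$. Two matrices $\bm{X},\bm{Y}\in\mathbb{R}^{m\times n}$ have a simultaneous ordered SVD if there are $\bm{U}\in\mathcal{O}(m)$, $\bm{V}\in\mathcal{O}(n)$ and a permutation $\bm{\pi}$ of the $t$ coordinates such that $\bm{X}=\bm{U}\mathcal{D}(\sigma(\bm{X}))\bm{V}^{\top}$ and $\bm{Y}=\bm{U}\mathcal{D}(\bm{\pi}(\sigma(\bm{Y})))\bm{V}^{\top}$, where $\bm{\pi}(\sigma(\bm{Y}))$ is the corresponding rearrangement of the singular values of $\bm{Y}$. A matrix $\bm{X}\in\mathcal{F}$ is called locally sparse if there is no $\bm{Y}\in\mathcal{F}\setminus\{\bm{X}\}$ such that $\bm{X}$ and $\bm{Y}$ have a simultaneous ordered SVD, that is, $\bm{X}=\bm{U}\mathcal{D}(\sigma(\bm{X}))\bm{V}^{\top}$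 and $\bm{Y}=\bm{U}\mathcal{D}(\bm{\pi}(\sigma(\bm{Y})))\bm{V}^{\top}$ for some $\bm{U}\in\mathcal{O}(m)$, $\bm{V}\in\mathcal{O}(n)$ and some permutation $\bm{\pi}$ of the $t$ coordinates, for which $\operatorname{supp}(\bm{\pi}(\sigma(\bm{Y})))\subseteq\operatorname{supp}(\sigma(\bm{X}))$. $\mathcal{F}_L$ denotes the set of all locally sparse $\bm{X}\in\mathcal{F}$. *)

theory Defs
  imports
    Complex_Main
    "HOL-Combinatorics.Permutations"
    "Jordan_Normal_Form.Matrix"
    "Jordan_Normal_Form.Char_Poly"
    "Jordan_Normal_Form.VS_Connect"
    "Jordan_Normal_Form.DL_Rank"
begin

text \<open>All vector and matrix indices start at 0, so the coordinates of a vector in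
  \<open>carrier_vec t\<close> are \<open>0, \<dots>, t - 1\<close>.\<close>

text \<open>The singular values of an \<open>m \<times> n\<close> matrix \<open>X\<close> are the square roots of the \<open>t = min m n\<close> largest
  eigenvalues of \<open>X\<^sup>T X\<close>, counted with algebraic multiplicity and listed in decreasing order.
  The characteristic polynomial of the symmetric \<open>n \<times> n\<close> matrix \<open>X\<^sup>T X\<close> splits over the reals into
  \<open>n\<close> linear factors, so the list indexed below has \<open>n \<ge> t\<close> entries.\<close>

definition singular_values :: "real mat \<Rightarrow> real vec" where
  "singular_values X =
     vec (min (dim_row X) (dim_col X))
       (\<lambda>i. sqrt (rev (sorted_list_of_multiset (proots (char_poly (transpose_mat X * X)))) ! i))"

definition nuclear_norm :: "real mat \<Rightarrow> real" where
  "nuclear_norm X = (\<Sum>i<dim_vec (singular_values X). singular_values X $ i)"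

definition frobenius_norm :: "real mat \<Rightarrow> real" where
  "frobenius_norm X = sqrt (\<Sum>i<dim_row X. \<Sum>j<dim_col X. (X $$ (i, j))\<^sup>2)"

definition rect_diag :: "nat \<Rightarrow> nat \<Rightarrow> real vec \<Rightarrow> real mat" where
  "rect_diag m n x = mat m n (\<lambda>(i, j). if i = j then x $ i else 0)"

text \<open>The library predicate \<open>orthogonal_mat\<close> only asks for pairwise orthogonal nonzero columns,
  hence the following definition of the orthogonal group.\<close>

definition orthogonal_group :: "nat \<Rightarrow> real mat set" where
  "orthogonal_group d =
     {U \<in> carrier_mat d d. transpose_mat U * U = 1\<^sub>m d \<and> U * transpose_mat U = 1\<^sub>m d}"

definition vec_support :: "real vec \<Rightarrow> nat set" where
  "vec_support x = {i. i < dim_vec x \<and> x $ i \<noteq> 0}"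

definition permute_vec :: "(nat \<Rightarrow> nat) \<Rightarrow> real vec \<Rightarrow> real vec" where
  "permute_vec p x = vec (dim_vec x) (\<lambda>i. x $ p i)"

text \<open>\<open>U\<close>, \<open>V\<close> and \<open>p\<close> witness a simultaneous ordered SVD of \<open>X\<close> and \<open>Y\<close>.\<close>

definition simultaneous_ordered_svd_by ::
  "nat \<Rightarrow> nat \<Rightarrow> real mat \<Rightarrow> real mat \<Rightarrow> (nat \<Rightarrow> nat) \<Rightarrow> real mat \<Rightarrow> real mat \<Rightarrow> bool" where
  "simultaneous_ordered_svd_by m n U V p X Y \<longleftrightarrow>
     U \<in> orthogonal_group m \<and> V \<in> orthogonal_group n \<and> p permutes {..<min m n} \<and>
     X = U * rect_diag m n (singular_values X) * transpose_mat V \<and>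
     Y = U * rect_diag m n (permute_vec p (singular_values Y)) * transpose_mat V"

definition locally_sparse :: "nat \<Rightarrow> nat \<Rightarrow> real mat set \<Rightarrow> real mat \<Rightarrow> bool" where
  "locally_sparse m n F X \<longleftrightarrow>
     X \<in> F \<and>
     \<not> (\<exists>Y \<in> F - {X}. \<exists>U V p.
           simultaneous_ordered_svd_by m n U V p X Y \<and>
           vec_support (permute_vec p (singular_values Y)) \<subseteq> vec_support (singular_values X))"

definition feasible_set ::
  "nat \<Rightarrow> nat \<Rightarrow> (real mat \<Rightarrow> real vec) \<Rightarrow> real vec \<Rightarrow> real mat set" where
  "feasible_set m n A b = {X \<in> carrier_mat m n. A X = b}"

definition unique_global_minimizer :: "('a \<Rightarrow> 'b::linorder) \<Rightarrow> 'a set \<Rightarrow> 'a \<Rightarrow> bool" where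
  "unique_global_minimizer f S x \<longleftrightarrow>
     is_arg_min f (\<lambda>y. y \<in> S) x \<and> (\<forall>y. is_arg_min f (\<lambda>z. z \<in> S) y \<longrightarrow> y = x)"

end

theory Submission
  imports
    Defs
    "Jordan_Normal_Form.Jordan_Normal_Form_Existence"
    "Jordan_Normal_Form.Jordan_Normal_Form_Uniqueness"
    "HOL-Analysis.L2_Norm"
begin

text \<open>Let \<open>f(X) = \<parallel>X\<parallel>\<^sub>* - \<parallel>X\<parallel>\<^sub>F\<close>, that is, the \<open>\<ell>\<^sub>1\<close> norm minus the \<open>\<ell>\<^sub>2\<close> norm of \<open>\<sigma>(X)\<close>.
  If a feasible \<open>X\<close> is not locally sparse, some feasible \<open>Y \<noteq> X\<close> shares the singular vectors of \<open>X\<close>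
  and has no larger support, so the line through \<open>X\<close> and \<open>Y\<close> is feasible and is described by the line
  through two nonnegative vectors \<open>x\<close> and \<open>y\<close>. These are linearly independent because \<open>b \<noteq> 0\<close>,
  hence \<open>\<ell>\<^sub>1 - \<ell>\<^sub>2\<close> is strictly concave on the part of that line inside the orthant; it is also
  bounded below there, so leaving the orthant in a suitable direction strictly decreases both \<open>f\<close>
  and the support. Repeating this ends at \<open>X\<^sup>*\<close> or at a locally sparse matrix.
  For a locally sparse \<open>X \<noteq> X\<^sup>*\<close> of rank \<open>r\<close> with smallest nonzero singular value \<open>\<mu>\<close>,
  \<open>f(X) \<ge> (r - 1)\<mu>/2 > (\<surd>s - 1)\<parallel>X\<^sup>*\<parallel>\<^sub>F \<ge> f(X\<^sup>*)\<close>.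

  No singular value decomposition of a general matrix is needed: the facts on \<open>\<sigma>(X)\<close> are read off
  the characteristic polynomial of \<open>X\<^sup>T X\<close>, whose root \<open>0\<close> has multiplicity \<open>dim ker X\<close> because
  \<open>X\<^sup>T X\<close> and its powers have the same kernel.\<close>

section \<open>The difference of the one-norm and the two-norm\<close>

text \<open>Strict Minkowski inequality. Non-proportionality is stated with both norms as factors,
  which avoids quotients and also rules out zero vectors.\<close>

lemma L2_set_add_less:
  fixes p q :: "'i \<Rightarrow> real"
  assumes fin: "finite I"
    and np: "\<not> (\<forall>i\<in>I. L2_set q I * p i = L2_set p I * q i)"
  shows "L2_set (\<lambda>i. p i + q i) I < L2_set p I + L2_set q I"
proof -
  define P Q R where "P = L2_set p I" and "Q = L2_set q I"
    and "R = (\<Sum>i\<in>I. p i * q i)"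
  have sq: "P\<^sup>2 = (\<Sum>i\<in>I. (p i)\<^sup>2)" "Q\<^sup>2 = (\<Sum>i\<in>I. (q i)\<^sup>2)"
    by (simp_all add: P_def Q_def L2_set_def sum_nonneg)
  have nn: "0 \<le> P" "0 \<le> Q" by (simp_all add: P_def Q_def)
  obtain j where j: "j \<in> I" "Q * p j - P * q j \<noteq> 0"
    using np by (auto simp: P_def Q_def)
  \<comment> \<open>Expanding this sum of squares yields strict Cauchy-Schwarz,
    \<open>R < P * Q\<close>.\<close>
  have "0 < (\<Sum>i\<in>I. (Q * p i - P * q i)\<^sup>2)"
    using fin j by (intro sum_pos2[of I j]) auto
  also have "\<dots> = (\<Sum>i\<in>I. Q\<^sup>2 * (p i)\<^sup>2 + P\<^sup>2 * (q i)\<^sup>2 - 2 * P * Q * (p i * q i))"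
    by (intro sum.cong) (auto simp: power2_eq_square algebra_simps)
  also have "\<dots> = Q\<^sup>2 * P\<^sup>2 + P\<^sup>2 * Q\<^sup>2 - 2 * P * Q * R"
    by (simp add: sum.distrib sum_subtractf sum_distrib_left sq R_def)
  also have "\<dots> = 2 * ((P * Q) * (P * Q - R))"
    by (simp add: power2_eq_square algebra_simps)
  finally have "R < P * Q" using mult_nonneg_nonneg[OF nn] by (simp add: zero_less_mult_iff)
  have "(\<Sum>i\<in>I. (p i + q i)\<^sup>2) = P\<^sup>2 + Q\<^sup>2 + 2 * R"
    by (simp add: sq R_def sum.distrib sum_distrib_left power2_sum mult.assoc)
  also have "\<dots> < (P + Q)\<^sup>2" using \<open>R < P * Q\<close> by (simp add: power2_sum)
  finally have "sqrt (\<Sum>i\<in>I. (p i + q i)\<^sup>2) < sqrt ((P + Q)\<^sup>2)" by (rule real_sqrt_less_mono)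
  then show ?thesis using nn by (simp add: P_def Q_def L2_set_def)
qed

definition l1_minus_l2 :: "'i set \<Rightarrow> ('i \<Rightarrow> real) \<Rightarrow> real" where
  "l1_minus_l2 I x = (\<Sum>i\<in>I. x i) - L2_set x I"

lemma l1_minus_l2_nonneg:
  assumes "finite I" "\<And>i. i \<in> I \<Longrightarrow> 0 \<le> x i"
  shows "0 \<le> l1_minus_l2 I x"
  using L2_set_le_sum[of I x] assms by (simp add: l1_minus_l2_def)

lemma l1_minus_l2_scale:
  assumes "0 \<le> c"
  shows "l1_minus_l2 I (\<lambda>i. c * x i) = c * l1_minus_l2 I x"
  using assms
  by (simp add: l1_minus_l2_def L2_set_right_distrib[symmetric] sum_distrib_left[symmetric] algebra_simps)

lemma l1_minus_l2_add_greater: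
  assumes "finite I"
    and "\<not> (\<forall>i\<in>I. L2_set q I * p i = L2_set p I * q i)"
  shows "l1_minus_l2 I p + l1_minus_l2 I q < l1_minus_l2 I (\<lambda>i. p i + q i)"
  using L2_set_add_less[OF assms] by (simp add: l1_minus_l2_def sum.distrib)

text \<open>The ratio test of linear programming: \<open>u\<close> is the first step at which a
  decreasing coordinate reaches zero, and \<open>j\<close> attains it. Since \<open>d\<close>
  vanishes where \<open>x\<close> does, decreasing coordinates start out positive, whence
  \<open>0 < u\<close>.\<close>

lemma first_exit_from_orthant:
  fixes x d :: "'i \<Rightarrow> real"
  assumes fin: "finite I" and x: "\<And>i. i \<in> I \<Longrightarrow> 0 \<le> x i"
    and d: "\<And>i. i \<in> I \<Longrightarrow> x i = 0 \<Longrightarrow> d i = 0"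
    and neg: "\<exists>i\<in>I. d i < 0"
  obtains u j where "0 < u" "\<And>i. i \<in> I \<Longrightarrow> 0 \<le> x i + u * d i"
    "j \<in> I" "x j \<noteq> 0" "x j + u * d j = 0"
proof -
  define N where "N = {i\<in>I. d i < 0}"
  define u where "u = Min ((\<lambda>i. x i / - d i) ` N)"
  have N: "finite N" "N \<noteq> {}" using fin neg by (auto simp: N_def)
  have "u \<in> (\<lambda>i. x i / - d i) ` N" unfolding u_def using N by (intro Min_in) auto
  then obtain j where j: "j \<in> N" "u = x j / - d j" by auto
  have xpos: "0 < x i" if "i \<in> N" for i
    using that x[of i] d[of i] unfolding N_def by force
  show thesis
  proof
    show "0 < u" using j xpos[of j] unfolding j(2) N_def by (auto intro!: divide_pos_neg)
    show "0 \<le> x i + u * d i" if i: "i \<in> I" for i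
    proof (cases "i \<in> N")
      case True
      then have "u \<le> x i / - d i" unfolding u_def using N by simp
      then show ?thesis using True by (simp add: N_def field_simps)
    next
      case False
      then show ?thesis using i x[of i] \<open>0 < u\<close> by (simp add: N_def)
    qed
    show "j \<in> I" "x j \<noteq> 0" using j xpos[of j] by (auto simp: N_def)
    show "x j + u * d j = 0" using j by (auto simp: N_def)
  qed
qed

lemma l1_minus_l2_descent_one_sided:
  fixes x d :: "'i \<Rightarrow> real"
  assumes fin: "finite I" and x: "\<And>i. i \<in> I \<Longrightarrow> 0 \<le> x i"
    and supp: "\<And>i. i \<in> I \<Longrightarrow> x i = 0 \<Longrightarrow> d i = 0"
    and indep: "\<And>\<alpha> \<beta>. (\<And>i. i \<in> I \<Longrightarrow> \<alpha> * x i + \<beta> * d i = 0) \<Longrightarrow> \<alpha> = 0 \<and> \<beta> = 0"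
    and neg: "\<And>i. i \<in> I \<Longrightarrow> d i \<le> 0"
  obtains u j where "\<And>i. i \<in> I \<Longrightarrow> 0 \<le> x i + u * d i"
    "j \<in> I" "x j \<noteq> 0" "x j + u * d j = 0"
    "l1_minus_l2 I (\<lambda>i. x i + u * d i) < l1_minus_l2 I x"
proof -
  have "\<exists>i\<in>I. d i < 0"
    using indep[of 0 1] neg by (force simp: less_le)
  from first_exit_from_orthant[of I x d, OF fin x supp this] obtain u j where u: "0 < u"
    "\<And>i. i \<in> I \<Longrightarrow> 0 \<le> x i + u * d i" "j \<in> I" "x j \<noteq> 0" "x j + u * d j = 0"
    by blast
  let ?p = "\<lambda>i. x i + u * d i" and ?q = "\<lambda>i. - u * d i"
  define P Q where "P = L2_set ?p I" and "Q = L2_set ?q I"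
  have "\<not> (\<forall>i\<in>I. Q * ?p i = P * ?q i)"
  proof
    assume "\<forall>i\<in>I. Q * ?p i = P * ?q i"
    \<comment> \<open>Proportionality amounts to a linear relation between x and d, so independence
      kills its coefficients.\<close>
    then have "Q * x i + (u * (Q + P)) * d i = 0" if "i \<in> I" for i
      using bspec[OF \<open>\<forall>i\<in>I. Q * ?p i = P * ?q i\<close> that] by (simp add: algebra_simps)
    from indep[OF this] have "Q = 0" by blast
    then have "\<forall>i\<in>I. d i = 0"
      using fin u(1) by (simp add: Q_def L2_set_eq_0_iff)
    then show False using indep[of 0 1] by auto
  qed
  from l1_minus_l2_add_greater[OF fin this[unfolded P_def Q_def]]
  have "l1_minus_l2 I ?p + l1_minus_l2 I ?q < l1_minus_l2 I x" by simp
  moreover have "0 \<le> l1_minus_l2 I ?q"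
    using fin u(1) neg by (intro l1_minus_l2_nonneg) (auto simp: mult_le_0_iff)
  ultimately have "l1_minus_l2 I ?p < l1_minus_l2 I x" by simp
  then show thesis using that u(2-) by blast
qed

text \<open>If d has entries of both signs, x lies strictly between two points where the line leaves
  the orthant. By strict superadditivity the value at x exceeds the weighted mean of the values at
  these exits, so at least one exit is a descent. If d has a single sign, the one-sided lemma
  applies to d or to -d.\<close>

lemma l1_minus_l2_descent:
  fixes x d :: "'i \<Rightarrow> real"
  assumes fin: "finite I" and x: "\<And>i. i \<in> I \<Longrightarrow> 0 \<le> x i"
    and supp: "\<And>i. i \<in> I \<Longrightarrow> x i = 0 \<Longrightarrow> d i = 0"
    and indep: "\<And>\<alpha> \<beta>. (\<And>i. i \<in> I \<Longrightarrow> \<alpha> * x i + \<beta> * d i = 0) \<Longrightarrow> \<alpha> = 0 \<and> \<beta> = 0"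
  obtains u j where "\<And>i. i \<in> I \<Longrightarrow> 0 \<le> x i + u * d i"
    "j \<in> I" "x j \<noteq> 0" "x j + u * d j = 0"
    "l1_minus_l2 I (\<lambda>i. x i + u * d i) < l1_minus_l2 I x"
proof -
  have indep': "\<alpha> = 0 \<and> \<beta> = 0" if "\<And>i. i \<in> I \<Longrightarrow> \<alpha> * x i + \<beta> * - d i = 0" for \<alpha> \<beta>
    using indep[of \<alpha> "- \<beta>"] that by simp
  have supp': "- d i = 0" if "i \<in> I" "x i = 0" for i
    using supp that by simp
  consider "\<forall>i\<in>I. d i \<le> 0" | "\<forall>i\<in>I. 0 \<le> d i" | "(\<exists>i\<in>I. d i < 0) \<and> (\<exists>i\<in>I. - d i < 0)"
    by force
  then show thesis
  proof cases
    case 1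
    then show ?thesis
      using l1_minus_l2_descent_one_sided[of I x d, OF fin x supp indep] that by blast
  next
    case 2
    then have "\<And>i. i \<in> I \<Longrightarrow> - d i \<le> 0" by simp
    from l1_minus_l2_descent_one_sided[of I x "\<lambda>i. - d i", OF fin x supp' indep' this]
    obtain u j where "\<And>i. i \<in> I \<Longrightarrow> 0 \<le> x i + u * - d i"
      "j \<in> I" "x j \<noteq> 0" "x j + u * - d j = 0"
      "l1_minus_l2 I (\<lambda>i. x i + u * - d i) < l1_minus_l2 I x" by blast
    then show ?thesis using that[of "- u" j] by simp
  next
    case 3
    from first_exit_from_orthant[of I x d, OF fin x supp conjunct1[OF 3]] obtain u j where u: "0 < u"
      "\<And>i. i \<in> I \<Longrightarrow> 0 \<le> x i + u * d i" "j \<in> I" "x j \<noteq> 0" "x j + u * d j = 0"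
      by blast
    from first_exit_from_orthant[of I x "\<lambda>i. - d i", OF fin x supp' conjunct2[OF 3]] obtain w k where w: "0 < w"
      "\<And>i. i \<in> I \<Longrightarrow> 0 \<le> x i + w * - d i" "k \<in> I" "x k \<noteq> 0" "x k + w * - d k = 0"
      by blast
    \<comment> \<open>The weights \<open>w\<close> and \<open>u\<close> are chosen to cancel d: the
      two vectors add up to (u + w) x.\<close>
    let ?p = "\<lambda>i. w * (x i + u * d i)" and ?q = "\<lambda>i. u * (x i + w * - d i)"
    define P Q where "P = L2_set ?p I" and "Q = L2_set ?q I"
    have PQ: "0 \<le> P" "0 \<le> Q" by (simp_all add: P_def Q_def)
    have "\<not> (\<forall>i\<in>I. Q * ?p i = P * ?q i)"
    proof
      assume "\<forall>i\<in>I. Q * ?p i = P * ?q i"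
      then have "(Q * w - P * u) * x i + (u * w * (P + Q)) * d i = 0" if "i \<in> I" for i
        using that by (simp add: algebra_simps)
      \<comment> \<open>Read off the coefficient of d. Then P = 0 makes the exit point x + u d
        vanish, again contradicting independence.\<close>
      from indep[OF this] have "P + Q = 0" using u(1) w(1) by auto
      then have "P = 0" using PQ by linarith
      then have "\<forall>i\<in>I. x i + u * d i = 0"
        using fin w(1) by (simp add: P_def L2_set_eq_0_iff)
      then show False using indep[of 1 u] by auto
    qed
    from l1_minus_l2_add_greater[OF fin this[unfolded P_def Q_def]]
    have "l1_minus_l2 I ?p + l1_minus_l2 I ?q < l1_minus_l2 I (\<lambda>i. ?p i + ?q i)" .
    also have "(\<lambda>i. ?p i + ?q i) = (\<lambda>i. (u + w) * x i)" by (auto simp: algebra_simps)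
    finally have *: "w * l1_minus_l2 I (\<lambda>i. x i + u * d i) + u * l1_minus_l2 I (\<lambda>i. x i + w * - d i)
        < (u + w) * l1_minus_l2 I x"
      using u(1) w(1) by (simp only: l1_minus_l2_scale less_imp_le add_nonneg_nonneg)
    show ?thesis
    proof (cases "l1_minus_l2 I (\<lambda>i. x i + u * d i) < l1_minus_l2 I x")
      case True
      then show ?thesis using that u(2-) by blast
    next
      case False
      then have "w * l1_minus_l2 I x \<le> w * l1_minus_l2 I (\<lambda>i. x i + u * d i)"
        using w(1) by simp
      with * have "u * l1_minus_l2 I (\<lambda>i. x i + w * - d i) < u * l1_minus_l2 I x"
        by (simp add: algebra_simps)
      then have "l1_minus_l2 I (\<lambda>i. x i + w * - d i) < l1_minus_l2 I x" using u(1) by simp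
      then show ?thesis using that[of "- w" k] w(2-) by simp
    qed
  qed
qed

text \<open>With S the one-norm and N the two-norm, S^2 - N^2 is the sum of all x_i (S - x_i), and
  each S - x_i collects \<open>card I - 1\<close> entries of size at least \<mu>. Dividing by S + N
  \<le> 2 S produces the factor 1/2.\<close>

lemma l1_minus_l2_ge:
  fixes x :: "'i \<Rightarrow> real"
  assumes fin: "finite I" and x: "\<And>i. i \<in> I \<Longrightarrow> \<mu> \<le> x i" and \<mu>: "0 < \<mu>" and "I \<noteq> {}"
  shows "(real (card I) - 1) / 2 * \<mu> \<le> l1_minus_l2 I x"
proof -
  define S N where "S = (\<Sum>i\<in>I. x i)" and "N = L2_set x I"
  have x0: "0 < x i" if "i \<in> I" for i using x[OF that] \<mu> by simp
  have S: "0 < S" unfolding S_def using fin x0 \<open>I \<noteq> {}\<close> by (intro sum_pos) auto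
  have N: "0 \<le> N" "N\<^sup>2 = (\<Sum>i\<in>I. (x i)\<^sup>2)" by (simp_all add: N_def L2_set_def sum_nonneg)
  have "N \<le> S"
    using l1_minus_l2_nonneg[OF fin, of x] x0 by (force simp: l1_minus_l2_def S_def N_def less_imp_le)
  have "S * ((real (card I) - 1) * \<mu>) = (\<Sum>i\<in>I. x i * ((real (card I) - 1) * \<mu>))"
    by (simp add: S_def sum_distrib_right)
  also have "\<dots> \<le> (\<Sum>i\<in>I. x i * (S - x i))"
  proof (intro sum_mono mult_left_mono)
    fix i assume i: "i \<in> I"
    have "real (card (I - {i})) * \<mu> \<le> (\<Sum>j\<in>I - {i}. x j)"
      using x by (intro sum_bounded_below) auto
    moreover have "(\<Sum>j\<in>I - {i}. x j) = S - x i"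
      using fin i by (simp add: S_def sum_diff1)
    moreover have "real (card (I - {i})) = real (card I) - 1"
      using fin i card_gt_0_iff[of I] by (auto simp: card_Diff_singleton of_nat_diff)
    ultimately show "(real (card I) - 1) * \<mu> \<le> S - x i" by simp
    show "0 \<le> x i" using x0[OF i] by simp
  qed
  also have "\<dots> = S\<^sup>2 - N\<^sup>2"
    by (simp add: right_diff_distrib sum_subtractf N(2)[unfolded power2_eq_square] S_def power2_eq_square flip: sum_distrib_right)
  also have "\<dots> = (S - N) * (S + N)" by (simp add: power2_eq_square algebra_simps)
  also have "\<dots> \<le> (S - N) * (2 * S)" using \<open>N \<le> S\<close> by (intro mult_left_mono) auto
  finally have "S * ((real (card I) - 1) * \<mu>) \<le> S * (2 * (S - N))" by (simp add: algebra_simps)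
  then have "(real (card I) - 1) * \<mu> \<le> 2 * (S - N)" using S by simp
  then show ?thesis by (simp add: l1_minus_l2_def S_def N_def)
qed

text \<open>Cauchy-Schwarz against the constant vector 1.\<close>

lemma sum_le_sqrt_card_mult_L2_set:
  "(\<Sum>i\<in>I. x i) \<le> sqrt (real (card I)) * L2_set x I"
proof -
  have "(\<Sum>i\<in>I. x i) \<le> (\<Sum>i\<in>I. \<bar>1\<bar> * \<bar>x i\<bar>)" by (intro sum_mono) auto
  also have "\<dots> \<le> L2_set (\<lambda>_. 1) I * L2_set x I" by (rule L2_set_mult_ineq)
  finally show ?thesis by (simp add: L2_set_def)
qed

section \<open>Eigenvalues of the Gram matrix\<close>

text \<open>A complex eigenvector v satisfies |X v|^2 = a |v|^2. In the order on
  \<open>complex\<close>, \<open>a \<ge> 0\<close> includes that a is real, which the splitting over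
  the reals relies on.\<close>

lemma gram_eigenvalue_nonneg:
  fixes X :: "real mat" and a :: complex
  assumes X: "X \<in> carrier_mat m n"
    and ev: "eigenvalue (map_mat complex_of_real (transpose_mat X * X)) a"
  shows "a \<ge> 0"
proof -
  define C where "C = map_mat complex_of_real X"
  have C: "C \<in> carrier_mat m n" and CT: "transpose_mat C \<in> carrier_mat n m"
    using X by (auto simp: C_def)
  have gram: "map_mat complex_of_real (transpose_mat X * X) = transpose_mat C * C"
    using X by (simp add: of_real_hom.mat_hom_mult[of _ n m _ n] C_def map_mat_transpose)
  obtain v where v: "v \<in> carrier_vec n" "v \<noteq> 0\<^sub>v n" "(transpose_mat C * C) *\<^sub>v v = a \<cdot>\<^sub>v v"
    using ev C unfolding gram eigenvalue_def eigenvector_def by auto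
  have Cv: "C *\<^sub>v v \<in> carrier_vec m" using C v by auto
  \<comment> \<open>The entries of \<open>C\<close> are real, so its transpose acts as its
    adjoint.\<close>
  have conj: "conjugate (C *\<^sub>v v) = C *\<^sub>v conjugate v"
  proof (rule eq_vecI)
    fix i assume "i < dim_vec (C *\<^sub>v conjugate v)"
    then have i: "i < m" using C by simp
    have "conjugate (row C i) = row C i"
      using C X i by (intro eq_vecI) (auto simp: C_def)
    then show "conjugate (C *\<^sub>v v) $ i = (C *\<^sub>v conjugate v) $ i"
      using C v i conjugate_sprod_vec[of "row C i" n v] by auto
  qed (use C in auto)
  have "(C *\<^sub>v v) \<bullet>c (C *\<^sub>v v) = (transpose_mat C *\<^sub>v (C *\<^sub>v v)) \<bullet>c v"
    unfolding conj using transpose_vec_mult_scalar[OF C _ Cv, of "conjugate v"] v Cv C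
    by (metis CT carrier_vec_conjugate comm_scalar_prod mult_mat_vec_carrier)
  also have "transpose_mat C *\<^sub>v (C *\<^sub>v v) = a \<cdot>\<^sub>v v"
    using v C by (metis CT assoc_mult_mat_vec)
  also have "(a \<cdot>\<^sub>v v) \<bullet>c v = a * (v \<bullet>c v)"
    using v by simp
  finally have eq: "(C *\<^sub>v v) \<bullet>c (C *\<^sub>v v) = a * (v \<bullet>c v)" .
  have pos: "v \<bullet>c v > 0" using v conjugate_square_greater_0_vec[OF v(1)] by auto
  have "(C *\<^sub>v v) \<bullet>c (C *\<^sub>v v) \<ge> 0" by (rule conjugate_square_ge_0_vec)
  then have "0 \<le> a * (v \<bullet>c v)" using eq by simp
  then show ?thesis using pos
    by (auto simp: less_eq_complex_def less_complex_def zero_le_mult_iff mult_less_0_iff)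
qed

text \<open>The polynomial factors over the complex numbers with real roots, and the factorization
  descends along the injective embedding of the reals.\<close>

lemma gram_char_poly_splits:
  fixes X :: "real mat"
  assumes X: "X \<in> carrier_mat m n"
  shows "\<exists>es. char_poly (transpose_mat X * X) = (\<Prod>a\<leftarrow>es. [:- a, 1:]) \<and> length es = n \<and>
    (\<forall>a\<in>set es. 0 \<le> a)"
proof -
  let ?B = "transpose_mat X * X"
  let ?C = "map_mat complex_of_real ?B"
  have B: "?B \<in> carrier_mat n n" and C: "?C \<in> carrier_mat n n" using X by auto
  obtain as where as: "char_poly ?C = (\<Prod>a\<leftarrow>as. [:- a, 1:])" "length as = n"
    using char_poly_factorized[OF C] by auto
  have nn: "0 \<le> a" if "a \<in> set as" for a
  proof (rule gram_eigenvalue_nonneg[OF X])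
    show "eigenvalue ?C a"
      unfolding eigenvalue_root_char_poly[OF C] as using that by (simp add: linear_poly_root)
  qed
  interpret mp: map_poly_inj_comm_ring_hom complex_of_real ..
  have "map_poly complex_of_real (char_poly ?B) = (\<Prod>a\<leftarrow>as. [:- a, 1:])"
    by (rule trans[OF of_real_hom.char_poly_hom[OF B, symmetric] as(1)])
  also have "\<dots> = (\<Prod>a\<leftarrow>as. map_poly complex_of_real [:- Re a, 1:])"
    using nn by (intro arg_cong[where f = prod_list] map_cong)
      (auto simp: less_eq_complex_def complex_eq_iff)
  also have "\<dots> = map_poly complex_of_real (\<Prod>a\<leftarrow>map Re as. [:- a, 1:])"
    by (simp add: mp.hom_prod_list o_def)
  finally have "char_poly ?B = (\<Prod>a\<leftarrow>map Re as. [:- a, 1:])"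
    using mp.injectivity by blast
  then show ?thesis
    using nn as(2) by (intro exI[of _ "map Re as"]) (auto simp: less_eq_complex_def)
qed

text \<open>The squared singular values together with \<open>n - t\<close> zeros, kept as a multiset
  so that most arguments avoid the sorting inside \<open>singular_values\<close>.\<close>

definition gram_eigs :: "real mat \<Rightarrow> real multiset" where
  "gram_eigs X = proots (char_poly (transpose_mat X * X))"

lemma proots_linear_factors:
  "proots (\<Prod>a\<leftarrow>es. [:- a, 1:]) = mset (es :: 'a :: idom list)"
proof (induction es)
  case (Cons a es)
  have "(\<Prod>a\<leftarrow>es. [:- a, 1:]) \<noteq> 0" by (auto simp: prod_list_zero_iff)
  then show ?case using Cons by (simp add: proots_mult del: mult_pCons_left)
qed simp

lemma gram_eigs:
  assumes "X \<in> carrier_mat m n"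
  shows size_gram_eigs: "size (gram_eigs X) = n"
    and gram_eigs_nonneg: "a \<in># gram_eigs X \<Longrightarrow> 0 \<le> a"
  using gram_char_poly_splits[OF assms] unfolding gram_eigs_def by (auto simp: proots_linear_factors)

section \<open>The trace and the sum of the Gram eigenvalues\<close>

definition mtrace :: "'a :: comm_ring_1 mat \<Rightarrow> 'a" where
  "mtrace A = (\<Sum>i<dim_row A. A $$ (i, i))"

lemma mtrace_mult_comm:
  assumes "A \<in> carrier_mat m n" "B \<in> carrier_mat n m"
  shows "mtrace (A * B) = mtrace (B * A)"
proof -
  have "mtrace (A * B) = (\<Sum>i<m. \<Sum>j<n. A $$ (i, j) * B $$ (j, i))"
    using assms by (simp add: mtrace_def scalar_prod_def atLeast0LessThan)
  also have "\<dots> = (\<Sum>j<n. \<Sum>i<m. B $$ (j, i) * A $$ (i, j))"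
    by (subst sum.swap) (simp add: mult.commute)
  also have "\<dots> = mtrace (B * A)"
    using assms by (simp add: mtrace_def scalar_prod_def atLeast0LessThan)
  finally show ?thesis .
qed

lemma mtrace_similar:
  assumes "A \<in> carrier_mat n n" "similar_mat_wit A B P Q"
  shows "mtrace A = mtrace B"
proof -
  note w = similar_mat_witD2[OF assms]
  have "mtrace A = mtrace ((P * B) * Q)" using w by simp
  also have "\<dots> = mtrace (Q * (P * B))" using w by (intro mtrace_mult_comm[of _ n n]) auto
  also have "Q * (P * B) = (Q * P) * B" using w by (metis assoc_mult_mat)
  also have "\<dots> = B" using w by simp
  finally show ?thesis .
qed

text \<open>A Schur decomposition makes \<open>A\<close> similar to a matrix with diagonal
  \<open>es\<close>, and the trace is invariant under similarity.\<close>

lemma mtrace_eq_sum_roots: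
  fixes A :: "'a :: conjugatable_ordered_field mat"
  assumes A: "A \<in> carrier_mat n n" and es: "char_poly A = (\<Prod>a\<leftarrow>es. [:- a, 1:])"
  shows "mtrace A = sum_list es"
proof -
  obtain B P Q where B: "schur_decomposition A es = (B, P, Q)" by (metis prod_cases3)
  have s: "similar_mat_wit A B P Q" "diag_mat B = es"
    using schur_decomposition[OF A es B] by auto
  have "mtrace A = mtrace B" by (rule mtrace_similar[OF A s(1)])
  also have "\<dots> = sum_list (diag_mat B)"
    by (simp add: mtrace_def diag_mat_def sum_list_sum_nth atLeast0LessThan)
  finally show ?thesis using s by simp
qed

text \<open>Both sides are the trace of \<open>transpose_mat X * X\<close>, computed once from its
  eigenvalues and once from its entries.\<close>

lemma sum_gram_eigs:
  assumes X: "X \<in> carrier_mat m n"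
  shows "sum_mset (gram_eigs X) = (frobenius_norm X)\<^sup>2"
proof -
  obtain es where es: "char_poly (transpose_mat X * X) = (\<Prod>a\<leftarrow>es. [:- a, 1:])"
    using gram_char_poly_splits[OF X] by auto
  have "sum_mset (gram_eigs X) = mtrace (transpose_mat X * X)"
    using X by (subst mtrace_eq_sum_roots[OF _ es, of n])
      (auto simp: gram_eigs_def es proots_linear_factors sum_mset_sum_list)
  also have "\<dots> = (\<Sum>j<n. \<Sum>i<m. (X $$ (i, j))\<^sup>2)"
    using X by (simp add: mtrace_def scalar_prod_def atLeast0LessThan power2_eq_square)
  also have "\<dots> = (\<Sum>i<m. \<Sum>j<n. (X $$ (i, j))\<^sup>2)" by (rule sum.swap)
  also have "\<dots> = (frobenius_norm X)\<^sup>2"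
    using X by (simp add: frobenius_norm_def sum_nonneg)
  finally show ?thesis .
qed

section \<open>Kernels and the multiplicity of the eigenvalue 0\<close>

lemma scalar_prod_self_eq_0_iff:
  fixes v :: "real vec"
  assumes "v \<in> carrier_vec n"
  shows "v \<bullet> v = 0 \<longleftrightarrow> v = 0\<^sub>v n"
  using conjugate_square_eq_0_vec[OF assms] by (simp add: conjugate_real_def)

text \<open>If X^T X v = 0, then |X v|^2 is the scalar product of X^T X v with v, hence 0.\<close>

lemma mat_kernel_gram:
  fixes X :: "real mat"
  assumes X: "X \<in> carrier_mat m n"
  shows "mat_kernel (transpose_mat X * X) = mat_kernel X"
proof (rule equalityI)
  have B: "transpose_mat X * X \<in> carrier_mat n n" and XT: "transpose_mat X \<in> carrier_mat n m"
    using X by auto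
  show "mat_kernel (transpose_mat X * X) \<subseteq> mat_kernel X"
  proof (rule subsetI)
    fix v assume "v \<in> mat_kernel (transpose_mat X * X)"
    then have v: "v \<in> carrier_vec n" "(transpose_mat X * X) *\<^sub>v v = 0\<^sub>v n"
      using mat_kernelD[OF B] by auto
    have Xv: "X *\<^sub>v v \<in> carrier_vec m" using X v by auto
    have "(X *\<^sub>v v) \<bullet> (X *\<^sub>v v) = (transpose_mat X *\<^sub>v (X *\<^sub>v v)) \<bullet> v"
      by (rule transpose_vec_mult_scalar[OF X v(1) Xv, symmetric])
    also have "transpose_mat X *\<^sub>v (X *\<^sub>v v) = 0\<^sub>v n"
      using v X XT by (metis assoc_mult_mat_vec)
    finally have "X *\<^sub>v v = 0\<^sub>v m" using scalar_prod_self_eq_0_iff[OF Xv] v by simp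
    then show "v \<in> mat_kernel X" by (intro mat_kernelI[OF X v(1)])
  qed
  show "mat_kernel X \<subseteq> mat_kernel (transpose_mat X * X)"
    by (rule mat_kernel_mult_subset[OF X XT])
qed

text \<open>Stands in for diagonalization: it says that a symmetric matrix has no Jordan block at 0
  of size above 1.\<close>

lemma mat_kernel_pow_symmetric:
  fixes B :: "real mat"
  assumes B: "B \<in> carrier_mat n n" and sym: "transpose_mat B = B"
  shows "mat_kernel (B ^\<^sub>m Suc k) = mat_kernel B"
proof (induction k)
  case 0
  then show ?case using B by simp
next
  case (Suc k)
  have Bk: "B ^\<^sub>m k \<in> carrier_mat n n" for k using B by simp
  have eq: "B ^\<^sub>m Suc k = B * B ^\<^sub>m k" for k
  proof (induction k)
    case (Suc k)
    have "B ^\<^sub>m Suc (Suc k) = (B * B ^\<^sub>m k) * B" using Suc by simp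
    also have "\<dots> = B * B ^\<^sub>m Suc k" using B Bk assoc_mult_mat[OF B Bk B] by simp
    finally show ?case .
  qed (use B in simp)
  have "mat_kernel (B ^\<^sub>m Suc (Suc k)) = mat_kernel (B ^\<^sub>m Suc k)"
  proof (rule equalityI)
    show "mat_kernel (B ^\<^sub>m Suc (Suc k)) \<subseteq> mat_kernel (B ^\<^sub>m Suc k)"
    proof (rule subsetI)
      fix v assume "v \<in> mat_kernel (B ^\<^sub>m Suc (Suc k))"
      then have v: "v \<in> carrier_vec n" "B ^\<^sub>m Suc (Suc k) *\<^sub>v v = 0\<^sub>v n"
        using mat_kernelD[OF Bk[of "Suc (Suc k)"]] by blast+
      define w where "w = B ^\<^sub>m k *\<^sub>v v"
      have w: "w \<in> carrier_vec n" unfolding w_def by (rule mult_mat_vec_carrier[OF Bk v(1)])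
      have step: "B ^\<^sub>m Suc j *\<^sub>v v = B *\<^sub>v (B ^\<^sub>m j *\<^sub>v v)" for j
        unfolding eq by (rule assoc_mult_mat_vec[OF B Bk v(1)])
      \<comment> \<open>Symmetry turns B^2 w into B^T B w, so the kernel of the Gram matrix gives B
        w = 0.\<close>
      have "(transpose_mat B * B) *\<^sub>v w = B ^\<^sub>m Suc (Suc k) *\<^sub>v v"
        unfolding step sym w_def[symmetric] by (rule assoc_mult_mat_vec[OF B B w])
      then have "w \<in> mat_kernel (transpose_mat B * B)"
        using v w B by (intro mat_kernelI[of _ n n]) auto
      then have "w \<in> mat_kernel B" using mat_kernel_gram[OF B] by simp
      then have "B *\<^sub>v w = 0\<^sub>v n" using mat_kernelD[OF B] by auto
      then have "B ^\<^sub>m Suc k *\<^sub>v v = 0\<^sub>v n"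
        unfolding step w_def .
      then show "v \<in> mat_kernel (B ^\<^sub>m Suc k)" using v by (intro mat_kernelI[OF Bk])
    qed
    show "mat_kernel (B ^\<^sub>m Suc k) \<subseteq> mat_kernel (B ^\<^sub>m Suc (Suc k))"
      unfolding eq[of "Suc k"] by (rule mat_kernel_mult_subset[OF Bk B])
  qed
  then show ?case using Suc by simp
qed

text \<open>The order of the root 0 is the total size of the Jordan blocks at 0, which is the kernel
  dimension of a high power; that kernel is already the kernel of \<open>B\<close>.\<close>

lemma order_0_char_poly_symmetric:
  fixes B :: "real mat"
  assumes B: "B \<in> carrier_mat n n" and sym: "transpose_mat B = B"
    and es: "char_poly B = (\<Prod>a\<leftarrow>es. [:- a, 1:])"
  shows "Polynomial.order 0 (char_poly B) = kernel_dim B"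
proof -
  obtain n_as where jnf: "jordan_nf B n_as" using jordan_nf_exists[OF B es] by auto
  \<comment> \<open>Larger than every block size, so \<open>min k n = n\<close>, and a successor, as
    the lemma on kernels of powers requires.\<close>
  define k where "k = Suc (sum_list (map fst n_as))"
  have cm: "char_matrix B 0 = B"
    using B by (intro eq_matI) (auto simp: char_matrix_def)
  have "Polynomial.order 0 (char_poly B) = (\<Sum>n\<leftarrow>map fst [(n, e)\<leftarrow>n_as. e = 0]. n)"
    by (simp add: jordan_nf_order[OF jnf] case_prod_unfold)
  also have "\<dots> = (\<Sum>n\<leftarrow>map fst [(n, e)\<leftarrow>n_as. e = 0]. min k n)"
  proof (intro arg_cong[where f = sum_list] map_cong refl)
    fix a assume "a \<in> set (map fst [(n, e)\<leftarrow>n_as. e = 0])"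
    then have "a \<in> set (map fst n_as)" by auto
    then show "a = min k a" using member_le_sum_list[of a "map fst n_as"] by (simp add: k_def)
  qed
  also have "\<dots> = kernel_dim (B ^\<^sub>m k)"
    using dim_gen_eigenspace[OF jnf, of 0 k] by (simp add: dim_gen_eigenspace_def cm)
  also have "\<dots> = kernel_dim B"
    unfolding k_def kernel_dim_def mat_kernel_pow_symmetric[OF B sym] using B by simp
  finally show ?thesis .
qed

section \<open>Rank, nullity and nonzero Gram eigenvalues\<close>

lemma linear_map_mult_mat_vec:
  fixes X :: "'a :: field mat"
  assumes X: "X \<in> carrier_mat m n"
  shows "linear_map class_ring (module_vec TYPE('a) n) (module_vec TYPE('a) m) ((*\<^sub>v) X)"
proof -
  interpret V: vec_space "TYPE('a)" n .
  interpret W: vec_space "TYPE('a)" m .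
  show ?thesis
    by (unfold_locales)
      (use X in \<open>auto simp: module_hom_def module_vec_simps class_ring_simps
        mult_add_distrib_mat_vec[OF X] mult_mat_vec[OF X]\<close>)
qed

lemma rank_plus_kernel_dim:
  fixes X :: "'a :: field mat"
  assumes X: "X \<in> carrier_mat m n"
  shows "vec_space.rank m X + kernel_dim X = n"
proof -
  interpret V: vec_space "TYPE('a)" n .
  interpret W: vec_space "TYPE('a)" m .
  interpret L: linear_map class_ring "module_vec TYPE('a) n" "module_vec TYPE('a) m" "(*\<^sub>v) X"
    by (rule linear_map_mult_mat_vec[OF X])
  have im: "L.imT = W.span (set (cols X))"
    using W.col_space_eq[OF X] X unfolding L.im_def W.col_space_def by (auto simp: module_vec_simps)
  have ker: "L.kerT = mat_kernel X"
    using X unfolding L.ker_def mat_kernel[OF X] by (auto simp: module_vec_simps)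
  show ?thesis
    using L.rank_nullity[OF V.fin_dim] X
    by (simp add: im ker W.rank_def kernel_dim_def V.dim_is_n)
qed

lemma rank_le_dim_row:
  fixes X :: "'a :: field mat"
  assumes X: "X \<in> carrier_mat m n"
  shows "vec_space.rank m X \<le> m"
proof -
  interpret W: vec_space "TYPE('a)" m .
  have "set (cols X) \<subseteq> carrier_vec m" using cols_dim[of X] X by auto
  then have "subspace class_ring (W.span (set (cols X))) W.V"
    by (intro W.span_is_subspace) (simp add: module_vec_simps)
  from W.subspace_dim[OF this W.fin_dim W.fin_dim_span_cols[OF X]]
  show ?thesis by (simp add: W.rank_def W.dim_is_n)
qed

text \<open>Of the n eigenvalues, exactly dim ker X are zero; rank-nullity turns the number of the
  others into the rank.\<close>

lemma rank_eq_size_gram_eigs: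
  assumes X: "X \<in> carrier_mat m n"
  shows "vec_space.rank m X = size {#a \<in># gram_eigs X. a \<noteq> 0#}"
proof -
  let ?B = "transpose_mat X * X"
  have B: "?B \<in> carrier_mat n n" using X by auto
  have sym: "transpose_mat ?B = ?B" using X by (simp add: transpose_mult[of _ n m _ n])
  obtain es where es: "char_poly ?B = (\<Prod>a\<leftarrow>es. [:- a, 1:])"
    using gram_char_poly_splits[OF X] by auto
  have nz: "char_poly ?B \<noteq> 0" unfolding es by (auto simp: prod_list_zero_iff)
  have "count (gram_eigs X) 0 = kernel_dim ?B"
    using nz order_0_char_poly_symmetric[OF B sym es] by (simp add: gram_eigs_def)
  also have "\<dots> = kernel_dim X"
    unfolding kernel_dim_def mat_kernel_gram[OF X] using X by simp
  finally have c: "count (gram_eigs X) 0 = kernel_dim X" .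
  have "n = size {#a \<in># gram_eigs X. a \<noteq> 0#} + size {#a \<in># gram_eigs X. \<not> a \<noteq> 0#}"
    unfolding size_union[symmetric] multiset_partition[symmetric] size_gram_eigs[OF X] ..
  also have "size {#a \<in># gram_eigs X. \<not> a \<noteq> 0#} = count (gram_eigs X) 0"
    by (simp add: filter_eq_replicate_mset)
  finally show ?thesis using c rank_plus_kernel_dim[OF X] by linarith
qed

section \<open>Singular values\<close>

text \<open>A nonzero entry at index \<open>t\<close> would be positive, and so would the
  \<open>t\<close> entries before it, which makes \<open>t + 1\<close> nonzero entries.\<close>

lemma sorted_desc_tail_zero:
  fixes xs :: "real list"
  assumes sorted: "sorted (rev xs)" and nn: "\<And>x. x \<in> set xs \<Longrightarrow> 0 \<le> x"
    and few: "length (filter (\<lambda>x. x \<noteq> 0) xs) \<le> t"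
  shows "drop t xs = replicate (length xs - t) 0"
proof (cases "t < length xs")
  case True
  have "xs ! t = 0"
  proof (rule ccontr)
    assume "xs ! t \<noteq> 0"
    then have pos: "0 < xs ! t" using nn True by (metis nth_mem order_le_less)
    have "filter (\<lambda>x. x \<noteq> 0) (take (Suc t) xs) = take (Suc t) xs"
    proof (rule filter_True, rule ballI)
      fix x assume "x \<in> set (take (Suc t) xs)"
      then obtain i where i: "i < Suc t" "x = xs ! i" using True by (auto simp: in_set_conv_nth)
      then have "xs ! t \<le> x"
        using sorted_rev_nth_mono[OF sorted, of i t] True by simp
      then show "x \<noteq> 0" using pos by simp
    qed
    then have "Suc t = length (filter (\<lambda>x. x \<noteq> 0) (take (Suc t) xs))" using True by simp
    also have "\<dots> \<le> length (filter (\<lambda>x. x \<noteq> 0) (take (Suc t) xs @ drop (Suc t) xs))"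
      unfolding filter_append by simp
    finally show False using few by simp
  qed
  then have "xs ! i = 0" if "t \<le> i" "i < length xs" for i
    using sorted_rev_nth_mono[OF sorted that] nn[of "xs ! i"] that by auto
  then show ?thesis by (intro nth_equalityI) auto
qed simp

text \<open>\<open>singular_values\<close> keeps only the \<open>t\<close> largest eigenvalues. The
  rank is at most \<open>t\<close>, so the \<open>n - t\<close> discarded ones are all zero, and
  order-free facts carry over from eigenvalues to singular values.\<close>

lemma singular_values_mset:
  assumes X: "X \<in> carrier_mat m n"
  defines "t \<equiv> min m n"
  shows "image_mset (($) (singular_values X)) (mset_set {..<t}) + replicate_mset (n - t) 0 =
    image_mset sqrt (gram_eigs X)"
proof -
  define L where "L = rev (sorted_list_of_multiset (gram_eigs X))"
  have mL: "mset L = gram_eigs X" by (simp add: L_def)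
  have len: "length L = n" using size_gram_eigs[OF X] mL by (metis size_mset)
  have "size {#a \<in># mset L. a \<noteq> 0#} \<le> t"
    using rank_eq_size_gram_eigs[OF X] rank_le_dim_row[OF X] vec_space.rank_le_nc[OF X]
    by (simp add: mL t_def)
  then have few: "length (filter (\<lambda>x. x \<noteq> 0) L) \<le> t" by (metis mset_filter size_mset)
  have "drop t L = replicate (length L - t) 0"
  proof (rule sorted_desc_tail_zero[OF _ _ few])
    show "sorted (rev L)" by (simp add: L_def)
    show "0 \<le> x" if "x \<in> set L" for x
      using that gram_eigs_nonneg[OF X, of x] by (simp flip: mL)
  qed
  then have tail: "drop t L = replicate (n - t) 0" by (simp add: len)
  have "length (sorted_list_of_multiset (proots (char_poly (transpose_mat X * X)))) = n"
    using len by (simp add: L_def gram_eigs_def)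
  then have "map sqrt (take t L) = map (($) (singular_values X)) [0..<t]"
    using X by (intro nth_equalityI)
      (auto simp: singular_values_def t_def L_def gram_eigs_def)
  then have "mset (map sqrt (take t L)) = image_mset (($) (singular_values X)) (mset_set {..<t})"
    by (simp add: atLeast0LessThan)
  moreover have "mset (map sqrt (drop t L)) = replicate_mset (n - t) 0" by (simp add: tail)
  moreover have "image_mset sqrt (gram_eigs X) = mset (map sqrt (take t L)) + mset (map sqrt (drop t L))"
    by (metis append_take_drop_id mL map_append mset_append mset_map)
  ultimately show ?thesis by simp
qed

lemma dim_singular_values [simp]:
  "dim_vec (singular_values X) = min (dim_row X) (dim_col X)"
  by (simp add: singular_values_def)

lemma singular_values_nonneg:
  assumes X: "X \<in> carrier_mat m n" and "i < min m n"
  shows "0 \<le> singular_values X $ i"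
proof -
  have "singular_values X $ i \<in># image_mset sqrt (gram_eigs X)"
    unfolding singular_values_mset[OF X, symmetric] using assms by auto
  then show ?thesis using gram_eigs_nonneg[OF X] by auto
qed

lemma frobenius_norm_eq_L2_set_singular_values:
  assumes X: "X \<in> carrier_mat m n"
  shows "frobenius_norm X = L2_set (($) (singular_values X)) {..<min m n}"
proof -
  have "(\<Sum>i<min m n. (singular_values X $ i)\<^sup>2) =
      (\<Sum>s\<in>#image_mset sqrt (gram_eigs X). s\<^sup>2)"
    unfolding singular_values_mset[OF X, symmetric]
    by (simp add: sum_unfold_sum_mset image_mset.compositionality o_def)
  also have "\<dots> = (\<Sum>a\<in>#gram_eigs X. a)"
    unfolding image_mset.compositionality o_def
    using gram_eigs_nonneg[OF X] by (intro arg_cong[where f = sum_mset] image_mset_cong) simp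
  also have "\<dots> = (frobenius_norm X)\<^sup>2" using sum_gram_eigs[OF X] by simp
  finally have "L2_set (($) (singular_values X)) {..<min m n} = \<bar>frobenius_norm X\<bar>"
    by (simp add: L2_set_def)
  then show ?thesis by (simp add: frobenius_norm_def sum_nonneg)
qed

lemma nuclear_minus_frobenius:
  assumes X: "X \<in> carrier_mat m n"
  shows "nuclear_norm X - frobenius_norm X = l1_minus_l2 {..<min m n} (($) (singular_values X))"
  using X by (simp add: nuclear_norm_def l1_minus_l2_def frobenius_norm_eq_L2_set_singular_values[OF X])

lemma card_nonzero_eq_size_filter:
  assumes "finite I"
  shows "card {i \<in> I. f i \<noteq> (0 :: real)} = size {#a \<in># image_mset f (mset_set I). a \<noteq> 0#}"
  using assms by (simp add: filter_mset_image_mset)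

lemma vec_support_singular_values:
  assumes "X \<in> carrier_mat m n"
  shows "vec_support (singular_values X) = {i \<in> {..<min m n}. singular_values X $ i \<noteq> 0}"
  using assms by (auto simp: vec_support_def)

lemma rank_eq_card_vec_support:
  assumes X: "X \<in> carrier_mat m n"
  shows "vec_space.rank m X = card (vec_support (singular_values X))"
proof -
  have "{#a \<in># replicate_mset (n - min m n) (0 :: real). a \<noteq> 0#} = {#}"
    by (simp add: multiset_eq_iff)
  then have "card (vec_support (singular_values X)) =
      size {#a \<in># image_mset sqrt (gram_eigs X). a \<noteq> 0#}"
    unfolding vec_support_singular_values[OF X] singular_values_mset[OF X, symmetric]
      card_nonzero_eq_size_filter[OF finite_lessThan]
    by simp
  also have "\<dots> = size {#a \<in># gram_eigs X. a \<noteq> 0#}"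
    by (simp add: filter_mset_image_mset)
  finally show ?thesis using rank_eq_size_gram_eigs[OF X] by simp
qed

section \<open>Singular values of a diagonal matrix between orthogonal factors\<close>

lemma gram_rect_diag:
  "transpose_mat (rect_diag m n z) * rect_diag m n z =
    mat n n (\<lambda>(i, j). if i = j \<and> i < min m n then (z $ i)\<^sup>2 else 0)"
proof (rule eq_matI)
  fix i j assume "i < dim_row (mat n n (\<lambda>(i, j). if i = j \<and> i < min m n then (z $ i)\<^sup>2 else 0))"
    "j < dim_col (mat n n (\<lambda>(i, j). if i = j \<and> i < min m n then (z $ i)\<^sup>2 else 0))"
  then have ij: "i < n" "j < n" by auto
  have "(transpose_mat (rect_diag m n z) * rect_diag m n z) $$ (i, j) =
      (\<Sum>k<m. (if k = i then z $ k else 0) * (if k = j then z $ k else 0))"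
    using ij by (simp add: rect_diag_def scalar_prod_def atLeast0LessThan)
  also have "\<dots> = (\<Sum>k<m. if k = i then (if i = j then (z $ i)\<^sup>2 else 0) else 0)"
    by (intro sum.cong) (auto simp: power2_eq_square)
  finally show "(transpose_mat (rect_diag m n z) * rect_diag m n z) $$ (i, j) =
      mat n n (\<lambda>(i, j). if i = j \<and> i < min m n then (z $ i)\<^sup>2 else 0) $$ (i, j)"
    using ij by simp
qed (auto simp: rect_diag_def)

text \<open>The Gram matrix becomes V (D^T D) V^T, which is similar to the diagonal matrix D^T
  D.\<close>

lemma gram_eigs_svd:
  assumes U: "U \<in> orthogonal_group m" and V: "V \<in> orthogonal_group n"
  defines "t \<equiv> min m n"
  shows "gram_eigs (U * rect_diag m n z * transpose_mat V) =
    image_mset (\<lambda>i. (z $ i)\<^sup>2) (mset_set {..<t}) + replicate_mset (n - t) 0"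
proof -
  define D where "D = rect_diag m n z"
  define G where "G = transpose_mat D * D"
  have D: "D \<in> carrier_mat m n" by (simp add: D_def rect_diag_def)
  have Uc: "U \<in> carrier_mat m m" "transpose_mat U * U = 1\<^sub>m m"
    and Vc: "V \<in> carrier_mat n n" "transpose_mat V * V = 1\<^sub>m n" "V * transpose_mat V = 1\<^sub>m n"
    using U V by (auto simp: orthogonal_group_def)
  have UD: "U * D \<in> carrier_mat m n" and G: "G \<in> carrier_mat n n"
    using Uc D by (auto simp: G_def)
  have T: "transpose_mat (U * D) * (U * D) = G"
  proof -
    have "transpose_mat (U * D) * (U * D) = (transpose_mat D * transpose_mat U) * (U * D)"
      using Uc D by (simp add: transpose_mult)
    also have "\<dots> = transpose_mat D * (transpose_mat U * (U * D))"
      using Uc D by (intro assoc_mult_mat[of _ n m _ m _ n]) auto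
    also have "transpose_mat U * (U * D) = (transpose_mat U * U) * D"
      using Uc D by (intro assoc_mult_mat[symmetric, of _ m m _ m _ n]) auto
    finally show ?thesis using D by (simp add: Uc G_def)
  qed
  let ?X = "U * D * transpose_mat V"
  have "transpose_mat ?X * ?X = (V * transpose_mat (U * D)) * (U * D * transpose_mat V)"
    using UD Vc by (simp add: transpose_mult[OF UD])
  also have "\<dots> = V * (transpose_mat (U * D) * (U * D * transpose_mat V))"
    using UD Vc by (intro assoc_mult_mat[of _ n n _ m _ n]) auto
  also have "transpose_mat (U * D) * (U * D * transpose_mat V) = G * transpose_mat V"
    unfolding T[symmetric] using UD Vc by (intro assoc_mult_mat[symmetric, of _ n m _ n _ n]) auto
  also have "V * (G * transpose_mat V) = V * G * transpose_mat V"
    using G Vc by (intro assoc_mult_mat[symmetric, of _ n n _ n _ n]) auto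
  finally have X: "transpose_mat ?X * ?X = V * G * transpose_mat V" .
  have "similar_mat_wit (transpose_mat ?X * ?X) G V (transpose_mat V)"
    unfolding X using G Vc by (intro similar_mat_witI[of _ _ n]) auto
  then have "char_poly (transpose_mat ?X * ?X) = char_poly G"
    by (intro char_poly_similar) (auto simp: similar_mat_def)
  also have "\<dots> = (\<Prod>a\<leftarrow>diag_mat G. [:- a, 1:])"
  proof (rule char_poly_upper_triangular[OF G])
    show "upper_triangular G" unfolding G_def D_def gram_rect_diag by auto
  qed
  finally have "gram_eigs ?X = mset (diag_mat G)"
    unfolding gram_eigs_def by (simp add: proots_linear_factors)
  also have "diag_mat G = map (\<lambda>i. if i < t then (z $ i)\<^sup>2 else 0) [0..<n]"
    unfolding diag_mat_def G_def D_def gram_rect_diag by (auto simp: t_def)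
  also have "[0..<n] = [0..<t] @ [t..<n]"
    using upt_add_eq_append[of 0 t "n - t"] by (simp add: t_def)
  also have "map (\<lambda>i. if i < t then (z $ i)\<^sup>2 else 0) ([0..<t] @ [t..<n]) =
      map (\<lambda>i. (z $ i)\<^sup>2) [0..<t] @ replicate (n - t) 0"
    by (auto intro: nth_equalityI)
  finally show ?thesis by (simp add: D_def atLeast0LessThan)
qed

text \<open>The entries of \<open>z\<close> may come in any order, so the comparison is one of
  multisets. Nonnegativity turns the square root of \<open>(z $ i)\<^sup>2\<close> into
  \<open>z $ i\<close>, and the padding zeros cancel.\<close>

lemma singular_values_svd:
  assumes U: "U \<in> orthogonal_group m" and V: "V \<in> orthogonal_group n"
    and z: "\<And>i. i < min m n \<Longrightarrow> 0 \<le> z $ i"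
  defines "X \<equiv> U * rect_diag m n z * transpose_mat V"
  shows "image_mset (($) (singular_values X)) (mset_set {..<min m n}) =
    image_mset (($) z) (mset_set {..<min m n})"
proof -
  have X: "X \<in> carrier_mat m n"
    using U V by (auto simp: X_def orthogonal_group_def rect_diag_def)
  have "image_mset (($) (singular_values X)) (mset_set {..<min m n}) +
      replicate_mset (n - min m n) 0 = image_mset sqrt (gram_eigs X)"
    by (rule singular_values_mset[OF X])
  also have "\<dots> = image_mset (\<lambda>i. sqrt ((z $ i)\<^sup>2)) (mset_set {..<min m n}) +
      replicate_mset (n - min m n) 0"
    unfolding X_def gram_eigs_svd[OF U V] by (simp add: image_mset.compositionality o_def)
  also have "image_mset (\<lambda>i. sqrt ((z $ i)\<^sup>2)) (mset_set {..<min m n}) =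
      image_mset (($) z) (mset_set {..<min m n})"
    using z by (intro image_mset_cong) auto
  finally show ?thesis by simp
qed

text \<open>The objective and the size of the support are symmetric functions of the singular
  values, so equality as multisets suffices.\<close>

lemma
  assumes U: "U \<in> orthogonal_group m" and V: "V \<in> orthogonal_group n"
    and z: "\<And>i. i < min m n \<Longrightarrow> 0 \<le> z $ i"
  defines "X \<equiv> U * rect_diag m n z * transpose_mat V"
  shows nuclear_minus_frobenius_svd:
      "nuclear_norm X - frobenius_norm X = l1_minus_l2 {..<min m n} (($) z)"
    and card_vec_support_svd:
      "card (vec_support (singular_values X)) = card {i \<in> {..<min m n}. z $ i \<noteq> 0}"
proof -
  have X: "X \<in> carrier_mat m n"
    using U V by (auto simp: X_def orthogonal_group_def rect_diag_def)
  note eq = singular_values_svd[OF U V z, folded X_def]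
  have sums: "(\<Sum>i<min m n. g (singular_values X $ i)) = (\<Sum>i<min m n. g (z $ i))"
    for g :: "real \<Rightarrow> real"
    using arg_cong[OF eq, of "\<lambda>M. sum_mset (image_mset g M)"]
    by (simp add: sum_unfold_sum_mset image_mset.compositionality o_def)
  show "nuclear_norm X - frobenius_norm X = l1_minus_l2 {..<min m n} (($) z)"
    unfolding nuclear_minus_frobenius[OF X] l1_minus_l2_def L2_set_def
    using sums[of "\<lambda>a. a"] sums[of "\<lambda>a. a\<^sup>2"] by simp
  show "card (vec_support (singular_values X)) = card {i \<in> {..<min m n}. z $ i \<noteq> 0}"
    unfolding vec_support_singular_values[OF X]
    by (simp only: card_nonzero_eq_size_filter[OF finite_lessThan] eq)
qed

section \<open>Descent on the feasible set\<close>

text \<open>For fixed \<open>U\<close> and \<open>V\<close>, this carries the line through two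
  coordinate vectors to the line through the two matrices.\<close>

lemma svd_linear:
  assumes U: "U \<in> carrier_mat m m" and V: "V \<in> carrier_mat n n"
    and z: "\<And>i. i < min m n \<Longrightarrow> z $ i = a * x $ i + c * y $ i"
  shows "U * rect_diag m n z * transpose_mat V =
    a \<cdot>\<^sub>m (U * rect_diag m n x * transpose_mat V) + c \<cdot>\<^sub>m (U * rect_diag m n y * transpose_mat V)"
proof -
  have D: "rect_diag m n w \<in> carrier_mat m n" for w by (simp add: rect_diag_def)
  have UD: "U * rect_diag m n w \<in> carrier_mat m n" for w by (rule mult_carrier_mat[OF U D])
  have VT: "transpose_mat V \<in> carrier_mat n n" using V by simp
  have "rect_diag m n z = a \<cdot>\<^sub>m rect_diag m n x + c \<cdot>\<^sub>m rect_diag m n y"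
    using z by (intro eq_matI) (auto simp: rect_diag_def)
  then have "U * rect_diag m n z = a \<cdot>\<^sub>m (U * rect_diag m n x) + c \<cdot>\<^sub>m (U * rect_diag m n y)"
    using mult_add_distrib_mat[OF U smult_carrier_mat[OF D] smult_carrier_mat[OF D]]
    by (simp add: mult_smult_distrib[OF U D])
  then show ?thesis
    using add_mult_distrib_mat[OF smult_carrier_mat[OF UD] smult_carrier_mat[OF UD] VT]
    by (simp add: mult_smult_assoc_mat[OF UD VT])
qed

section \<open>Linear combinations of feasible matrices\<close>

lemma linear_map_mat_carrier:
  fixes A :: "real mat \<Rightarrow> real vec"
  assumes "linear_map class_ring (module_mat TYPE(real) m n) (module_vec TYPE(real) l) A"
    and "X \<in> carrier_mat m n"
  shows "A X \<in> carrier_vec l"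
proof -
  interpret L: linear_map class_ring "module_mat TYPE(real) m n" "module_vec TYPE(real) l" A
    by fact
  show ?thesis
    using L.f_im[of X] assms(2) by (simp add: module_mat_simps module_vec_simps)
qed

lemma linear_map_mat_lincomb:
  fixes A :: "real mat \<Rightarrow> real vec"
  assumes "linear_map class_ring (module_mat TYPE(real) m n) (module_vec TYPE(real) l) A"
    and "X \<in> carrier_mat m n" "Y \<in> carrier_mat m n"
  shows "A (a \<cdot>\<^sub>m X + c \<cdot>\<^sub>m Y) = a \<cdot>\<^sub>v A X + c \<cdot>\<^sub>v A Y"
proof -
  interpret L: linear_map class_ring "module_mat TYPE(real) m n" "module_vec TYPE(real) l" A
    by fact
  have smult: "A (k \<cdot>\<^sub>m Z) = k \<cdot>\<^sub>v A Z" if "Z \<in> carrier_mat m n" for k Z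
    using L.f_smult[of k Z] that by (simp add: module_mat_simps module_vec_simps class_ring_simps)
  have "A (a \<cdot>\<^sub>m X + c \<cdot>\<^sub>m Y) = A (a \<cdot>\<^sub>m X) + A (c \<cdot>\<^sub>m Y)"
    using L.f_add[of "a \<cdot>\<^sub>m X" "c \<cdot>\<^sub>m Y"] assms(2,3)
    by (simp add: module_mat_simps module_vec_simps)
  then show ?thesis using smult assms(2,3) by simp
qed

lemma linear_map_mat_zero:
  fixes A :: "real mat \<Rightarrow> real vec"
  assumes A: "linear_map class_ring (module_mat TYPE(real) m n) (module_vec TYPE(real) l) A"
  shows "A (0\<^sub>m m n) = 0\<^sub>v l"
proof -
  have Z: "0\<^sub>m m n \<in> carrier_mat m n" by simp
  have "A (0 \<cdot>\<^sub>m 0\<^sub>m m n + 0 \<cdot>\<^sub>m 0\<^sub>m m n) = 0 \<cdot>\<^sub>v A (0\<^sub>m m n) + 0 \<cdot>\<^sub>v A (0\<^sub>m m n)"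
    by (rule linear_map_mat_lincomb[OF A Z Z])
  also have "\<dots> = 0\<^sub>v l"
    using linear_map_mat_carrier[OF A Z] by (intro eq_vecI) auto
  finally show ?thesis by simp
qed

text \<open>Serves two ends: coefficients with sum 1 stay in the feasible set, and for nonzero
  \<open>b\<close> a vanishing combination must have coefficient sum 0.\<close>

lemma feasible_lincomb:
  fixes A :: "real mat \<Rightarrow> real vec"
  assumes A: "linear_map class_ring (module_mat TYPE(real) m n) (module_vec TYPE(real) l) A"
    and b: "b \<in> carrier_vec l"
    and X: "X \<in> feasible_set m n A b" and Y: "Y \<in> feasible_set m n A b"
  shows "A (a \<cdot>\<^sub>m X + c \<cdot>\<^sub>m Y) = (a + c) \<cdot>\<^sub>v b"
proof -
  have "A (a \<cdot>\<^sub>m X + c \<cdot>\<^sub>m Y) = a \<cdot>\<^sub>v b + c \<cdot>\<^sub>v b"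
    using linear_map_mat_lincomb[OF A, of X Y a c] X Y by (simp add: feasible_set_def)
  then show ?thesis by (simp add: add_smult_distrib_vec)
qed

text \<open>Applying \<open>A\<close> gives (a + c) b = 0, so c = -a; what remains is a (X - Y) = 0
  with X \<noteq> Y.\<close>

lemma feasible_lin_indep:
  fixes A :: "real mat \<Rightarrow> real vec"
  assumes A: "linear_map class_ring (module_mat TYPE(real) m n) (module_vec TYPE(real) l) A"
    and b: "b \<in> carrier_vec l" "b \<noteq> 0\<^sub>v l"
    and X: "X \<in> feasible_set m n A b" and Y: "Y \<in> feasible_set m n A b"
    and "X \<noteq> Y" and zero: "a \<cdot>\<^sub>m X + c \<cdot>\<^sub>m Y = 0\<^sub>m m n"
  shows "a = 0 \<and> c = 0"
proof -
  have "(a + c) \<cdot>\<^sub>v b = 0\<^sub>v l"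
    using feasible_lincomb[OF A b(1) X Y, of a c] linear_map_mat_zero[OF A] zero by simp
  moreover obtain i where "i < l" "b $ i \<noteq> 0" using b by (auto simp: vec_eq_iff)
  ultimately have "a + c = 0"
    using b(1) by (auto simp: vec_eq_iff)
  then have c: "c = - a" by simp
  have "a * (X $$ (i, j) - Y $$ (i, j)) = 0" if "i < m" "j < n" for i j
  proof -
    have "(a \<cdot>\<^sub>m X + c \<cdot>\<^sub>m Y) $$ (i, j) = a * X $$ (i, j) + c * Y $$ (i, j)"
      using that X Y by (auto simp: feasible_set_def)
    then have "a * X $$ (i, j) + c * Y $$ (i, j) = 0" using that by (simp add: zero)
    then show ?thesis by (simp add: c algebra_simps)
  qed
  moreover have "\<exists>i<m. \<exists>j<n. X $$ (i, j) \<noteq> Y $$ (i, j)"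
    using \<open>X \<noteq> Y\<close> X Y by (auto simp: feasible_set_def mat_eq_iff)
  ultimately show ?thesis using c by auto
qed

lemma not_locally_sparse_descent:
  fixes A :: "real mat \<Rightarrow> real vec"
  assumes A: "linear_map class_ring (module_mat TYPE(real) m n) (module_vec TYPE(real) l) A"
    and b: "b \<in> carrier_vec l" "b \<noteq> 0\<^sub>v l"
    and X: "X \<in> feasible_set m n A b"
    and not_ls: "\<not> locally_sparse m n (feasible_set m n A b) X"
  obtains Z where "Z \<in> feasible_set m n A b"
    "nuclear_norm Z - frobenius_norm Z < nuclear_norm X - frobenius_norm X"
    "card (vec_support (singular_values Z)) < card (vec_support (singular_values X))"
proof -
  let ?F = "feasible_set m n A b" and ?I = "{..<min m n}"
  obtain Y U V p where Y: "Y \<in> ?F" "Y \<noteq> X"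
    and svd: "simultaneous_ordered_svd_by m n U V p X Y"
    and supp: "vec_support (permute_vec p (singular_values Y)) \<subseteq> vec_support (singular_values X)"
    using X not_ls unfolding locally_sparse_def by auto
  have Xc: "X \<in> carrier_mat m n" and Yc: "Y \<in> carrier_mat m n"
    using X Y by (auto simp: feasible_set_def)
  define x y where "x = singular_values X" and "y = permute_vec p (singular_values Y)"
  have U: "U \<in> orthogonal_group m" and V: "V \<in> orthogonal_group n" and p: "p permutes ?I"
    and Xeq: "X = U * rect_diag m n x * transpose_mat V"
    and Yeq: "Y = U * rect_diag m n y * transpose_mat V"
    using svd by (auto simp: simultaneous_ordered_svd_by_def x_def y_def)
  have Uc: "U \<in> carrier_mat m m" and Vc: "V \<in> carrier_mat n n"
    using U V by (auto simp: orthogonal_group_def)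
  have x0: "0 \<le> x $ i" if "i \<in> ?I" for i
    using singular_values_nonneg[OF Xc] that by (simp add: x_def)
  \<comment> \<open>The support condition makes the direction y - x vanish wherever x does, as the
    vector descent demands.\<close>
  have y_supp: "y $ i = 0" if "i \<in> ?I" "x $ i = 0" for i
    using supp that Xc Yc by (auto simp: vec_support_def x_def y_def permute_vec_def subset_iff)
  define d where "d = (\<lambda>i. y $ i - x $ i)"
  have d_supp: "d i = 0" if "i \<in> ?I" "x $ i = 0" for i
    using y_supp[OF that] that by (simp add: d_def)
  \<comment> \<open>Since \<alpha> x + \<beta> d = (\<alpha> - \<beta>) x + \<beta> y, a relation
    between x and d is one between \<open>X\<close> and \<open>Y\<close>, which are
    independent.\<close>
  have indep: "\<alpha> = 0 \<and> \<beta> = 0" if eq: "\<And>i. i \<in> ?I \<Longrightarrow> \<alpha> * x $ i + \<beta> * d i = 0" for \<alpha> \<beta>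
  proof -
    have "U * rect_diag m n (0\<^sub>v (min m n)) * transpose_mat V =
        (\<alpha> - \<beta>) \<cdot>\<^sub>m X + \<beta> \<cdot>\<^sub>m Y"
      unfolding Xeq Yeq
      by (rule svd_linear[OF Uc Vc]) (use eq in \<open>auto simp: d_def algebra_simps\<close>)
    moreover have "rect_diag m n (0\<^sub>v (min m n)) = 0\<^sub>m m n"
      by (intro eq_matI) (auto simp: rect_diag_def)
    ultimately have "(\<alpha> - \<beta>) \<cdot>\<^sub>m X + \<beta> \<cdot>\<^sub>m Y = 0\<^sub>m m n"
      using Uc Vc by simp
    from feasible_lin_indep[OF A b X Y(1) Y(2)[symmetric] this] show ?thesis by simp
  qed
  obtain u j where u: "\<And>i. i \<in> ?I \<Longrightarrow> 0 \<le> x $ i + u * d i"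
    and j: "j \<in> ?I" "x $ j \<noteq> 0" "x $ j + u * d j = 0"
    and less: "l1_minus_l2 ?I (\<lambda>i. x $ i + u * d i) < l1_minus_l2 ?I (($) x)"
    using l1_minus_l2_descent[of ?I "($) x" d, OF _ x0 d_supp indep] by blast
  define z where "z = vec (min m n) (\<lambda>i. x $ i + u * d i)"
  have z: "z $ i = x $ i + u * d i" if "i \<in> ?I" for i using that by (simp add: z_def)
  define Z where "Z = U * rect_diag m n z * transpose_mat V"
  \<comment> \<open>The coefficients add up to 1, whatever the sign of \<open>u\<close>, so
    \<open>Z\<close> is feasible.\<close>
  have "Z = (1 - u) \<cdot>\<^sub>m X + u \<cdot>\<^sub>m Y"
    unfolding Z_def Xeq Yeq
    by (rule svd_linear[OF Uc Vc]) (simp add: z d_def algebra_simps)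
  then have "Z \<in> ?F"
    using feasible_lincomb[OF A b(1) X Y(1), of "1 - u" u] Xc Yc by (simp add: feasible_set_def)
  moreover have "nuclear_norm Z - frobenius_norm Z < nuclear_norm X - frobenius_norm X"
  proof -
    have "nuclear_norm Z - frobenius_norm Z = l1_minus_l2 ?I (($) z)"
      unfolding Z_def by (rule nuclear_minus_frobenius_svd[OF U V]) (use u z in auto)
    also have "\<dots> = l1_minus_l2 ?I (\<lambda>i. x $ i + u * d i)"
      by (simp add: l1_minus_l2_def L2_set_def z)
    finally show ?thesis using less nuclear_minus_frobenius[OF Xc] by (simp add: x_def)
  qed
  moreover have "card (vec_support (singular_values Z)) < card (vec_support (singular_values X))"
  proof -
    have "card (vec_support (singular_values Z)) = card {i \<in> ?I. z $ i \<noteq> 0}"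
      unfolding Z_def by (rule card_vec_support_svd[OF U V]) (use u z in auto)
    \<comment> \<open>No index enters the support because d vanishes off it, and the exit index
      \<open>j\<close> leaves it.\<close>
    also have "\<dots> < card {i \<in> ?I. x $ i \<noteq> 0}"
    proof (rule psubset_card_mono)
      have "{i \<in> ?I. z $ i \<noteq> 0} \<subseteq> {i \<in> ?I. x $ i \<noteq> 0}"
        using z d_supp by auto
      moreover have "j \<in> {i \<in> ?I. x $ i \<noteq> 0}" "j \<notin> {i \<in> ?I. z $ i \<noteq> 0}"
        using j z by auto
      ultimately show "{i \<in> ?I. z $ i \<noteq> 0} \<subset> {i \<in> ?I. x $ i \<noteq> 0}" by blast
    qed simp
    finally show ?thesis by (simp add: vec_support_singular_values[OF Xc] x_def)
  qed
  ultimately show thesis by (rule that)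
qed

section \<open>Bounds on the objective in terms of the rank\<close>

lemma l1_minus_l2_restrict:
  assumes "finite I" "J \<subseteq> I" "\<And>i. i \<in> I - J \<Longrightarrow> x i = 0"
  shows "l1_minus_l2 I x = l1_minus_l2 J x"
proof -
  have "sum x I = sum x J" using assms by (intro sum.mono_neutral_right) auto
  moreover have "(\<Sum>i\<in>I. (x i)\<^sup>2) = (\<Sum>i\<in>J. (x i)\<^sup>2)"
    using assms by (intro sum.mono_neutral_right) auto
  ultimately show ?thesis by (simp add: l1_minus_l2_def L2_set_def)
qed

lemma nuclear_minus_frobenius_restrict:
  assumes X: "X \<in> carrier_mat m n"
  shows "nuclear_norm X - frobenius_norm X =
    l1_minus_l2 (vec_support (singular_values X)) (($) (singular_values X))"
  unfolding nuclear_minus_frobenius[OF X]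
  by (rule l1_minus_l2_restrict) (auto simp: vec_support_singular_values[OF X])

text \<open>Restricting to the support leaves as many entries as the rank, each at least their
  positive minimum.\<close>

lemma nuclear_minus_frobenius_ge:
  assumes X: "X \<in> carrier_mat m n" and ne: "vec_support (singular_values X) \<noteq> {}"
  shows "(real (vec_space.rank m X) - 1) / 2 *
      Min ((\<lambda>i. singular_values X $ i) ` vec_support (singular_values X))
    \<le> nuclear_norm X - frobenius_norm X"
  unfolding nuclear_minus_frobenius_restrict[OF X] rank_eq_card_vec_support[OF X]
proof (rule l1_minus_l2_ge)
  let ?S = "vec_support (singular_values X)"
  show fin: "finite ?S" by (simp add: vec_support_def)
  show "Min ((\<lambda>i. singular_values X $ i) ` ?S) \<le> singular_values X $ i" if "i \<in> ?S" for i
    using fin that by simp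
  have "Min ((\<lambda>i. singular_values X $ i) ` ?S) \<in> (\<lambda>i. singular_values X $ i) ` ?S"
    using fin ne by (intro Min_in) auto
  then obtain i where "i \<in> ?S" "Min ((\<lambda>i. singular_values X $ i) ` ?S) = singular_values X $ i"
    by auto
  then show "0 < Min ((\<lambda>i. singular_values X $ i) ` ?S)"
    using singular_values_nonneg[OF X, of i] by (auto simp: vec_support_singular_values[OF X])
qed (rule ne)

lemma nuclear_minus_frobenius_le:
  assumes X: "X \<in> carrier_mat m n"
  shows "nuclear_norm X - frobenius_norm X
    \<le> (sqrt (real (vec_space.rank m X)) - 1) * frobenius_norm X"
proof -
  let ?S = "vec_support (singular_values X)" and ?\<sigma> = "($) (singular_values X)"
  have "L2_set ?\<sigma> {..<min m n} = L2_set ?\<sigma> ?S"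
    unfolding L2_set_def vec_support_singular_values[OF X]
    by (intro arg_cong[where f = sqrt] sum.mono_neutral_right) auto
  then have "frobenius_norm X = L2_set ?\<sigma> ?S"
    by (simp add: frobenius_norm_eq_L2_set_singular_values[OF X])
  then show ?thesis
    using sum_le_sqrt_card_mult_L2_set[of ?\<sigma> ?S]
    unfolding nuclear_minus_frobenius_restrict[OF X] rank_eq_card_vec_support[OF X]
    by (simp add: l1_minus_l2_def algebra_simps)
qed

text \<open>Rank 0 means that all singular values vanish, hence so does the Frobenius norm.\<close>

lemma rank_pos:
  fixes X :: "real mat"
  assumes X: "X \<in> carrier_mat m n" and "X \<noteq> 0\<^sub>m m n"
  shows "0 < vec_space.rank m X"
proof (rule ccontr)
  assume "\<not> 0 < vec_space.rank m X"
  moreover have "finite (vec_support (singular_values X))" by (simp add: vec_support_def)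
  ultimately have "vec_support (singular_values X) = {}"
    by (simp add: rank_eq_card_vec_support[OF X])
  then have "L2_set (($) (singular_values X)) {..<min m n} = 0"
    unfolding vec_support_singular_values[OF X] by (auto simp: L2_set_eq_0_iff)
  then have "frobenius_norm X = 0" by (simp add: frobenius_norm_eq_L2_set_singular_values[OF X])
  then have "\<forall>i<m. \<forall>j<n. X $$ (i, j) = 0"
    using X by (auto simp: frobenius_norm_def sum_nonneg_eq_0_iff sum_nonneg)
  then have "X = 0\<^sub>m m n" using X by (intro eq_matI) auto
  with \<open>X \<noteq> 0\<^sub>m m n\<close> show False by simp
qed

theorem theorem7:
  fixes m n l s :: nat
    and A :: "real mat \<Rightarrow> real vec"
    and b :: "real vec"
    and Xstar :: "real mat"
  assumes "linear_map class_ring (module_mat TYPE(real) m n) (module_vec TYPE(real) l) A"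
    and "b \<in> carrier_vec l"
    and "b \<noteq> 0\<^sub>v l"
    and "unique_global_minimizer (vec_space.rank m) (feasible_set m n A b) Xstar"
    and "vec_space.rank m Xstar = s"
    and "\<forall>X \<in> {X. locally_sparse m n (feasible_set m n A b) X} - {Xstar}.
           Min ((\<lambda>i. singular_values X $ i) ` vec_support (singular_values X))
             > 2 * (sqrt (real s) - 1) / (real (vec_space.rank m X) - 1) * frobenius_norm Xstar"
  shows "unique_global_minimizer (\<lambda>X. nuclear_norm X - frobenius_norm X)
           (feasible_set m n A b) Xstar"
proof -
  let ?F = "feasible_set m n A b" and ?f = "\<lambda>X. nuclear_norm X - frobenius_norm X"
  have star: "Xstar \<in> ?F"
    using assms(4) by (simp add: unique_global_minimizer_def is_arg_min_def)
  \<comment> \<open>Uniqueness makes the comparison strict: a feasible matrix of rank at most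
    \<open>s\<close> would itself be a minimizer.\<close>
  have rank_less: "s < vec_space.rank m X" if "X \<in> ?F" "X \<noteq> Xstar" for X
  proof (rule ccontr)
    assume "\<not> s < vec_space.rank m X"
    then have "is_arg_min (vec_space.rank m) (\<lambda>y. y \<in> ?F) X"
      using assms(4,5) that(1)
      by (auto simp: unique_global_minimizer_def is_arg_min_def not_less intro: order_trans)
    then show False using assms(4) that(2) by (simp add: unique_global_minimizer_def)
  qed
  have Xstar: "Xstar \<in> carrier_mat m n" using star by (simp add: feasible_set_def)
  have "Xstar \<noteq> 0\<^sub>m m n"
    using star linear_map_mat_zero[OF assms(1)] assms(3) by (auto simp: feasible_set_def)
  then have s: "1 \<le> s" using rank_pos[OF Xstar] assms(5) by simp
  have sparse: "?f Xstar < ?f X" if X: "locally_sparse m n ?F X" "X \<noteq> Xstar" for X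
  proof -
    have XF: "X \<in> ?F" using X by (simp add: locally_sparse_def)
    then have Xc: "X \<in> carrier_mat m n" by (simp add: feasible_set_def)
    define r where "r = vec_space.rank m X"
    let ?\<mu> = "Min ((\<lambda>i. singular_values X $ i) ` vec_support (singular_values X))"
    \<comment> \<open>From 1 \<le> s < r, so the denominator in the hypothesis on singular values is
      positive and can be cleared.\<close>
    have r: "0 < real r - 1" using rank_less[OF XF X(2)] s by (simp add: r_def)
    have ne: "vec_support (singular_values X) \<noteq> {}"
      using r rank_eq_card_vec_support[OF Xc] by (auto simp: r_def)
    have "2 * (sqrt (real s) - 1) / (real r - 1) * frobenius_norm Xstar < ?\<mu>"
      using assms(6) X by (simp add: r_def)
    then have "(sqrt (real s) - 1) * frobenius_norm Xstar < (real r - 1) / 2 * ?\<mu>"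
      using r by (simp add: field_simps)
    then show ?thesis
      using nuclear_minus_frobenius_le[OF Xstar] nuclear_minus_frobenius_ge[OF Xc ne] assms(5)
      by (simp add: r_def)
  qed
  have less: "?f Xstar < ?f X" if "X \<in> ?F" "X \<noteq> Xstar" for X
    using that
  \<comment> \<open>The induction runs on the number of nonzero singular values, which every descent
    step lowers.\<close>
  proof (induction "card (vec_support (singular_values X))" arbitrary: X rule: less_induct)
    case less
    show ?case
    proof (cases "locally_sparse m n ?F X")
      case True
      then show ?thesis using sparse less.prems by simp
    next
      case False
      from not_locally_sparse_descent[OF assms(1-3) less.prems(1) this] obtain Z
        where Z: "Z \<in> ?F" "?f Z < ?f X"
          "card (vec_support (singular_values Z)) < card (vec_support (singular_values X))"
        by blast
      \<comment> \<open>If the descent lands on \<open>Xstar\<close>, its strict decrease is already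
        the claim; otherwise the induction hypothesis for \<open>Z\<close> is chained with
        it.\<close>
      then show ?thesis using less.hyps[OF Z(3,1)] by (cases "Z = Xstar") auto
    qed
  qed
  have min: "?f Xstar \<le> ?f X" if "X \<in> ?F" for X
    using less[OF that] by (cases "X = Xstar") auto
  show ?thesis
    unfolding unique_global_minimizer_def is_arg_min_def
  proof (intro conjI allI impI)
    show "\<nexists>X. X \<in> ?F \<and> ?f X < ?f Xstar" using min by (auto simp: not_less)
    show "X = Xstar" if "X \<in> ?F \<and> (\<nexists>Y. Y \<in> ?F \<and> ?f Y < ?f X)" for X
      using less[of X] that star by blast
  qed (rule star)
qed

end
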